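(* Let $p,q$ be positive integers and $b>0$ a real number. Let $\Delta_p$ be a $p$-dimensional regular simplex (i.e. its $p+1$ vertices) with side length $b$ and $\Delta_q$ a $q$-dimensional regular simplex with side length $b$. Then for every positive integer $r$, every coloring of $\mathbb{E}^{pq+2}$ with $r$ colors contains a rainbow configuration congruent to $\Delta_p$ or a monochromatic configuration congruent to $\Delta_q$.
   Context: $\mathbb{E}^d$ is $d$-dimensional Euclidean space; an $r$-coloring assigns one of $r$ colors to each point. A point set is monochromatic if all its points have the same color and rainbow if its points have pairwise distinct colors. *)

theory Defs
  imports "HOL-Analysis.Analysis"
begin

text \<open>A regular simplex is represented by its vertex set, as opposed to the library's
  \<^term>\<open>n simplex S\<close>, which is the convex hull.\<close>

definition regular_simplex :: "nat \<Rightarrow> real \<Rightarrow> 'a::euclidean_space set \<Rightarrow> bool" where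
  "regular_simplex d b S \<longleftrightarrow>
     finite S \<and> card S = d + 1 \<and> \<not> affine_dependent S \<and>
     (\<forall>x\<in>S. \<forall>y\<in>S. x \<noteq> y \<longrightarrow> dist x y = b)"

text \<open>The two configurations may live in Euclidean spaces of different dimensions, so
  congruence is witnessed by an isometry between the sets themselves and not by a rigid motion
  of one ambient space.\<close>

definition congruent_sets :: "'a::euclidean_space set \<Rightarrow> 'b::euclidean_space set \<Rightarrow> bool" where
  "congruent_sets S T \<longleftrightarrow>
     (\<exists>f. bij_betw f S T \<and> (\<forall>x\<in>S. \<forall>y\<in>S. dist (f x) (f y) = dist x y))"

definition coloring :: "nat \<Rightarrow> ('a \<Rightarrow> nat) \<Rightarrow> bool" where
  "coloring r c \<longleftrightarrow> (\<forall>x. c x < r)"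

definition monochromatic :: "('a \<Rightarrow> nat) \<Rightarrow> 'a set \<Rightarrow> bool" where
  "monochromatic c S \<longleftrightarrow> (\<forall>x\<in>S. \<forall>y\<in>S. c x = c y)"

definition rainbow :: "('a \<Rightarrow> nat) \<Rightarrow> 'a set \<Rightarrow> bool" where
  "rainbow c S \<longleftrightarrow> (\<forall>x\<in>S. \<forall>y\<in>S. x \<noteq> y \<longrightarrow> c x \<noteq> c y)"

end

theory Submission
  imports Defs
begin

text \<open>
  In dimension at least \<open>p * q\<close> there are \<open>p * q + 1\<close> points at mutual distance \<open>b\<close>. Either they
  receive more than \<open>p\<close> colors, and one point of each color gives a rainbow \<open>p\<close>-simplex, or they
  receive at most \<open>p\<close> colors, and by pigeonhole some color class contains a \<open>q\<close>-simplex.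
\<close>

text \<open>Only one nonzero distance occurs in either set, so any bijection between them is
  automatically an isometry.\<close>

lemma congruent_sets_equidistant:
  fixes S :: "'a::euclidean_space set" and T :: "'b::euclidean_space set"
  assumes "finite S" "finite T" "card S = card T"
    and S: "\<And>x y. \<lbrakk>x \<in> S; y \<in> S; x \<noteq> y\<rbrakk> \<Longrightarrow> dist x y = b"
    and T: "\<And>x y. \<lbrakk>x \<in> T; y \<in> T; x \<noteq> y\<rbrakk> \<Longrightarrow> dist x y = b"
  shows "congruent_sets S T"
proof -
  obtain f where f: "bij_betw f S T"
    using assms(1-3) finite_same_card_bij by blast
  have "dist (f x) (f y) = dist x y" if "x \<in> S" "y \<in> S" for x y
  proof (cases "x = y")
    case False
    then have "f x \<noteq> f y" "f x \<in> T" "f y \<in> T"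
      using f that by (auto simp: bij_betw_def inj_on_def)
    then show ?thesis using S T that False by simp
  qed simp
  then show ?thesis using f unfolding congruent_sets_def by blast
qed

text \<open>This reduces the search for a congruent copy of a simplex to counting: inside an
  equidistant set, having \<open>d + 1\<close> points is enough.\<close>

lemma simplex_congruent_equidistant_subset:
  fixes \<Delta> :: "'a::euclidean_space set" and X :: "'b::euclidean_space set"
  assumes "regular_simplex d b \<Delta>" and "finite X"
    and "\<And>x y. \<lbrakk>x \<in> X; y \<in> X; x \<noteq> y\<rbrakk> \<Longrightarrow> dist x y = b"
    and "S \<subseteq> X" and "card S = d + 1"
  shows "congruent_sets \<Delta> S"
proof (rule congruent_sets_equidistant)
  show "dist x y = b" if "x \<in> S" "y \<in> S" "x \<noteq> y" for x y
    using that assms(3,4) by blast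
qed (use assms in \<open>auto simp: regular_simplex_def intro: finite_subset\<close>)

text \<open>Pigeonhole: at most \<open>p\<close> values, each taken at most \<open>q\<close> times,
  would account for at most \<open>p * q\<close> points.\<close>

lemma many_values_or_large_fibre:
  assumes "finite X" and "card X > p * q"
  obtains (inj) S where "S \<subseteq> X" "card S = p + 1" "inj_on c S"
    | (const) S y where "S \<subseteq> X" "card S = q + 1" "\<And>x. x \<in> S \<Longrightarrow> c x = y"
proof (cases "card (c ` X) \<ge> p + 1")
  case True
  then obtain Y where Y: "Y \<subseteq> c ` X" "card Y = p + 1"
    by (meson obtain_subset_with_card_n)
  \<comment> \<open>\<open>S\<close> is a transversal: one preimage is chosen for each of the
    \<open>p + 1\<close> values in \<open>Y\<close>.\<close>
  then obtain S where "S \<subseteq> X" "inj_on c S" "Y = c ` S"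
    by (auto simp: subset_image_inj)
  with Y show thesis by (intro inj) (auto simp: card_image)
next
  case few: False
  have "\<exists>y. card {x \<in> X. c x = y} \<ge> q + 1"
  proof (rule ccontr)
    assume "\<not> ?thesis"
    then have le: "card {x \<in> X. c x = y} \<le> q" for y
      by (simp add: not_le less_Suc_eq_le)
    \<comment> \<open>The fibres over the image partition \<open>X\<close>; summing the constant 1
      over them counts its points.\<close>
    have "card X = (\<Sum>y\<in>c ` X. card {x \<in> X. c x = y})"
      using sum.image_gen[OF \<open>finite X\<close>, of "\<lambda>_. 1::nat" c] by simp
    also have "\<dots> \<le> card (c ` X) * q"
      using sum_bounded_above[of "c ` X" _ q] le by simp
    also have "\<dots> \<le> p * q" using few by (intro mult_right_mono) auto
    finally show False using assms by simp
  qed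
  then obtain y S where "S \<subseteq> {x \<in> X. c x = y}" "card S = q + 1"
    by (meson obtain_subset_with_card_n)
  then show thesis by (intro const[of S y]) auto
qed

text \<open>Pythagoras: distinct axes are orthogonal, so the cross terms in the squared norm
  vanish.\<close>

lemma dist_scaled_axes:
  fixes i j :: "'n::finite"
  assumes "i \<noteq> j"
  shows "dist (axis i a :: real ^ 'n) (axis j a) = sqrt 2 * \<bar>a\<bar>"
proof -
  have "(norm (axis i a - axis j a :: real ^ 'n))\<^sup>2 = 2 * a\<^sup>2"
    using assms unfolding power2_norm_eq_inner
    by (simp add: inner_diff inner_axis_axis power2_eq_square)
  then show ?thesis
    by (metis dist_norm norm_ge_zero real_sqrt_abs real_sqrt_mult real_sqrt_unique)
qed

lemma equidistant_set_exists:
  fixes b :: real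
  assumes "b > 0"
  obtains X :: "(real ^ 'n::finite) set"
  where "finite X" "card X = CARD('n)" "\<And>x y. \<lbrakk>x \<in> X; y \<in> X; x \<noteq> y\<rbrakk> \<Longrightarrow> dist x y = b"
proof
  \<comment> \<open>Distinct points at height \<open>a\<close> on the axes are
    \<open>sqrt 2 * \<bar>a\<bar>\<close> apart, which fixes the scale
    \<open>b / sqrt 2\<close>.\<close>
  let ?X = "range (\<lambda>i. axis i (b / sqrt 2) :: real ^ 'n)"
  show "finite ?X" by simp
  \<comment> \<open>Positivity of \<open>b\<close> matters here: with scale 0 all these points would
    collapse to the origin.\<close>
  have "inj (\<lambda>i. axis i (b / sqrt 2) :: real ^ 'n)"
    using assms by (auto simp: inj_def axis_eq_axis)
  then show "card ?X = CARD('n)" by (rule card_image)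
  show "dist x y = b" if xy: "x \<in> ?X" "y \<in> ?X" "x \<noteq> y" for x y
  proof -
    obtain i j where "x = axis i (b / sqrt 2)" "y = axis j (b / sqrt 2)"
      using xy by auto
    moreover from this xy have "i \<noteq> j" by auto
    ultimately show ?thesis using assms by (simp add: dist_scaled_axes)
  qed
qed

theorem theorem5:
  fixes p q r :: nat and b :: real
    and \<Delta>p :: "'a::euclidean_space set" and \<Delta>q :: "'b::euclidean_space set"
    and c :: "real ^ 'n::finite \<Rightarrow> nat"
  assumes "p > 0" and "q > 0" and "b > 0" and "r > 0"
    and "CARD('n) = p * q + 2"
    and "regular_simplex p b \<Delta>p"
    and "regular_simplex q b \<Delta>q"
    and "coloring r c"
  shows "(\<exists>S. congruent_sets \<Delta>p S \<and> rainbow c S) \<or>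
         (\<exists>S. congruent_sets \<Delta>q S \<and> monochromatic c S)"
proof -
  obtain X :: "(real ^ 'n) set" where X: "finite X" "card X = CARD('n)"
    and dist: "\<And>x y. \<lbrakk>x \<in> X; y \<in> X; x \<noteq> y\<rbrakk> \<Longrightarrow> dist x y = b"
    using equidistant_set_exists[OF \<open>b > 0\<close>] by blast
  \<comment> \<open>One point per coordinate axis gives \<open>p * q + 2\<close> points, enough for
    the pigeonhole dichotomy.\<close>
  have "card X > p * q" using X assms by simp
  with X(1) show ?thesis
  proof (cases rule: many_values_or_large_fibre[where c = c])
    case (inj S)
    then have "rainbow c S" by (auto simp: rainbow_def inj_on_def)
    with inj simplex_congruent_equidistant_subset[OF assms(6) X(1) dist]
    show ?thesis by blast
  next
    case (const S y)
    then have "monochromatic c S" by (simp add: monochromatic_def)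
    with const simplex_congruent_equidistant_subset[OF assms(7) X(1) dist]
    show ?thesis by blast
  qed
qed

end
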